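(* Let $C$ be a real constant and suppose the Koml\'os conjecture holds with constant $C$. Let $n \ge 1$ be an integer and let $p_1, \dots, p_n$ be univariate real polynomials of degree less than $n$ with $\int_{0}^\pi p_i(\cos \theta)^2 \, \mathrm{d} \theta \le 1$ for all $i \in \{1,\dots,n\}$. Then there exist signs $x_1, \dots, x_n \in \{-1,1\}$ such that \[\Big\|\sum_{i=1}^n x_i p_i\Big\|_\infty < 3C\sqrt{n}.\]
   Context: For a univariate real polynomial $p : \mathbb{R} \to \mathbb{R}$, the Chebyshev norm is $\|p\|_\infty := \sup_{|x| \le 1} |p(x)|$, the supremum being over real $x \in [-1,1]$. "The Koml\'os conjecture holds with constant $C$" means: for every integer $m \ge 1$ and all vectors $v_1, \dots, v_m \in \mathbb{R}^m$ with Euclidean norm $\|v_i\|_2 \le 1$ for all $i \in \{1,\dots,m\}$, there exist signs $x_1, \dots, x_m \in \{-1,1\}$ such that $\|\sum_{i=1}^m x_i v_i\|_\infty \le C$, where for vectors $\|\cdot\|_\infty$ is the maximum absolute value of the coordinates. (This is a hypothesis of the theorem, and the constant $C$ does not depend on $m$.) *)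

theory Defs
  imports "HOL-Analysis.Analysis" "HOL-Computational_Algebra.Polynomial"
begin

definition chebyshev_norm :: "real poly \<Rightarrow> real" where
  "chebyshev_norm p = (SUP x\<in>{-1..1}. \<bar>poly p x\<bar>)"

(* A vector of R^m is a function nat => real of which only the coordinates 1, ..., m
   matter: the Komlos statement quantifies over the dimension m, so m cannot be a type.
   The Euclidean norm of w in R^m is then L2_set w {1..m}, and its maximum norm is
   max_norm m w, which is only meaningful for m >= 1. *)

definition max_norm :: "nat \<Rightarrow> (nat \<Rightarrow> real) \<Rightarrow> real" where
  "max_norm m w = (MAX j\<in>{1..m}. \<bar>w j\<bar>)"

definition komlos_conjecture :: "real \<Rightarrow> bool" where
  "komlos_conjecture C \<longleftrightarrow>
    (\<forall>m\<ge>1. \<forall>v :: nat \<Rightarrow> nat \<Rightarrow> real.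
      (\<forall>i\<in>{1..m}. L2_set (v i) {1..m} \<le> 1) \<longrightarrow>
      (\<exists>x :: nat \<Rightarrow> real. (\<forall>i\<in>{1..m}. x i \<in> {-1, 1}) \<and>
        max_norm m (\<lambda>j. \<Sum>i=1..m. x i * v i j) \<le> C))"

end

theory Submission
  imports Defs
begin

text \<open>
  Apply the Komlos hypothesis in dimension \<open>4 n\<close> to the vectors of samples of
  \<open>p\<^sub>i (cos \<theta>)\<close> at the points \<open>2 \<pi> j / (4 n)\<close>. Equally spaced quadrature is exact for the
  squares, so scaling by \<open>sqrt (\<pi> / (4 n))\<close> makes the vectors short, and the signed sum is
  bounded by \<open>C sqrt (4 n / \<pi>)\<close> at all sample points. A cosine polynomial of degree less than
  \<open>n\<close> is reproduced from its samples by the de la Vallee-Poussin kernel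
  \<open>(G\<^bsub>3n\<^esub> - G\<^bsub>n\<^esub>) / (2 n)\<close>, where \<open>G\<^sub>m\<close> is \<open>m\<close> times the Fejer kernel. As \<open>G\<^sub>m\<close> is nonnegative
  with mean \<open>m\<close> over the sample points, the sup norm is at most \<open>(3 n + n) / (2 n) = 2\<close>
  times the largest sample, and \<open>2 sqrt (4 / \<pi>) < 3\<close>.
\<close>

section \<open>Cosine polynomials and substitution of cos t into a polynomial\<close>

definition cos_poly :: "nat \<Rightarrow> (real \<Rightarrow> real) \<Rightarrow> bool" where
  "cos_poly d f \<longleftrightarrow> (\<exists>a. \<forall>t. f t = (\<Sum>k<d. a k * cos (real k * t)))"

lemma cos_poly_zero: "cos_poly d (\<lambda>t. 0)"
  unfolding cos_poly_def by (rule exI[of _ "\<lambda>_. 0"]) simp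

lemma cos_poly_add:
  assumes "cos_poly d f" "cos_poly d g"
  shows "cos_poly d (\<lambda>t. f t + g t)"
proof -
  obtain a b where "\<And>t. f t = (\<Sum>k<d. a k * cos (real k * t))"
    and "\<And>t. g t = (\<Sum>k<d. b k * cos (real k * t))"
    using assms unfolding cos_poly_def by metis
  then show ?thesis
    unfolding cos_poly_def
    by (intro exI[of _ "\<lambda>k. a k + b k"]) (simp add: sum.distrib distrib_right)
qed

lemma cos_poly_cmult:
  assumes "cos_poly d f"
  shows "cos_poly d (\<lambda>t. c * f t)"
proof -
  obtain a where "\<And>t. f t = (\<Sum>k<d. a k * cos (real k * t))"
    using assms unfolding cos_poly_def by metis
  then show ?thesis
    unfolding cos_poly_def
    by (intro exI[of _ "\<lambda>k. c * a k"]) (simp add: sum_distrib_left mult.assoc)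
qed

lemma cos_poly_sum:
  assumes "\<And>i. i \<in> A \<Longrightarrow> cos_poly d (f i)"
  shows "cos_poly d (\<lambda>t. \<Sum>i\<in>A. f i t)"
  using assms by (induction A rule: infinite_finite_induct) (auto simp: cos_poly_zero intro!: cos_poly_add)

lemma cos_poly_cos:
  assumes "k < d"
  shows "cos_poly d (\<lambda>t. cos (real k * t))"
  unfolding cos_poly_def
proof (intro exI allI)
  fix t
  show "cos (real k * t) = (\<Sum>i<d. (if i = k then 1 else 0) * cos (real i * t))"
    using assms by (simp add: if_distrib[of "\<lambda>x. x * _"] cong: if_cong)
qed

text \<open>By the product formula, multiplying by cos t moves frequency k to k + 1 and k - 1, each
  with weight 1/2; k = 0 goes to frequency 1 alone.\<close>

lemma cos_poly_times_cos:
  assumes "cos_poly d f"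
  shows "cos_poly (Suc d) (\<lambda>t. cos t * f t)"
proof -
  obtain a where a: "\<And>t. f t = (\<Sum>k<d. a k * cos (real k * t))"
    using assms unfolding cos_poly_def by metis
  have "cos_poly (Suc d) (\<lambda>t. cos t * cos (real k * t))" if "k < d" for k
  proof (cases k)
    case 0
    then show ?thesis using cos_poly_cos[of 1 "Suc d"] that by simp
  next
    case (Suc l)
    have *: "cos t * cos (real k * t) = 1/2 * cos (real (Suc k) * t) + 1/2 * cos (real l * t)" for t
      using cos_times_cos[of "real k * t" t] by (simp add: Suc algebra_simps)
    show ?thesis
      unfolding * by (intro cos_poly_add cos_poly_cmult cos_poly_cos) (use that Suc in auto)
  qed
  then have "cos_poly (Suc d) (\<lambda>t. \<Sum>k<d. a k * (cos t * cos (real k * t)))"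
    by (intro cos_poly_sum cos_poly_cmult) simp
  also have "(\<lambda>t. \<Sum>k<d. a k * (cos t * cos (real k * t))) = (\<lambda>t. cos t * f t)"
    by (simp add: a sum_distrib_left mult.left_commute)
  finally show ?thesis .
qed

lemma cos_poly_poly:
  assumes "degree p < d"
  shows "cos_poly d (\<lambda>t. poly p (cos t))"
  using assms
proof (induction p arbitrary: d)
  case 0
  then show ?case by (simp add: cos_poly_zero)
next
  case (pCons c q)
  have c: "cos_poly d (\<lambda>t. c)"
    using cos_poly_cmult[OF cos_poly_cos[of 0 d], of c] pCons.prems by simp
  have "cos_poly d (\<lambda>t. cos t * poly q (cos t))"
  \<comment> \<open>Only for nonzero \<open>q\<close> does \<open>pCons c q\<close> have degree one
    more than \<open>q\<close>, which leaves room for the factor cos t.\<close>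
  proof (cases "q = 0")
    case True
    then show ?thesis by (simp add: cos_poly_zero)
  next
    case False
    then obtain e where "d = Suc e" "degree q < e"
      using pCons.prems by (cases d) auto
    then show ?thesis using cos_poly_times_cos pCons.IH by blast
  qed
  from cos_poly_add[OF c this] show ?case by simp
qed

section \<open>Discrete orthogonality and exact quadrature\<close>

lemma sum_cos_equally_spaced:
  fixes r :: int
  assumes "\<bar>r\<bar> < int M"
  shows "(\<Sum>j=1..M. cos (\<alpha> - of_int r * (2 * pi * real j / real M)))
    = (if r = 0 then real M * cos \<alpha> else 0)"
proof (cases "r = 0")
  case True
  then show ?thesis by simp
next
  case False
  define h where "h = of_int r * (2 * pi / real M)"
  have M: "M > 0" using assms by auto
  \<comment> \<open>If h/2 were a multiple of pi, M would divide r, impossible for 0 < |r| <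
    M.\<close>
  have nz: "sin (h / 2) \<noteq> 0"
  proof
    assume "sin (h / 2) = 0"
    then obtain i :: int where "h / 2 = of_int i * pi"
      using sin_zero_iff_int2 by auto
    then have "of_int r = (of_int i * of_int (int M) :: real)"
      using M by (simp add: h_def field_simps)
    then have r: "r = i * int M"
      unfolding of_int_mult[symmetric] of_int_eq_iff .
    then have "i \<noteq> 0" using False by auto
    then have "1 * int M \<le> \<bar>i\<bar> * int M" by (intro mult_right_mono) auto
    then show False using assms r by (simp add: abs_mult)
  qed
  \<comment> \<open>The factor 2 sin(h/2) makes the sum of cosines telescope into a difference of
    sines.\<close>
  have "2 * sin (h / 2) * (\<Sum>j=1..M. cos (\<alpha> - real j * h))
      = (\<Sum>j=1..M. sin (\<alpha> + h / 2 - real j * h) - sin (\<alpha> + h / 2 - real (Suc j) * h))"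
    unfolding sum_distrib_left
  proof (rule sum.cong[OF refl])
    fix j
    show "2 * sin (h / 2) * cos (\<alpha> - real j * h)
      = sin (\<alpha> + h / 2 - real j * h) - sin (\<alpha> + h / 2 - real (Suc j) * h)"
      using sin_add[of "\<alpha> - real j * h" "h / 2"] sin_diff[of "\<alpha> - real j * h" "h / 2"]
      by (simp add: algebra_simps)
  qed
  also have "\<dots> = sin (\<alpha> - h / 2) - sin (\<alpha> + h / 2 - real (Suc M) * h)"
    using sum_Suc_diff[of 1 M "\<lambda>j. - sin (\<alpha> + h / 2 - real j * h)"]
    by (simp add: algebra_simps)
  \<comment> \<open>As M h = 2 pi r, the two ends of the telescope differ by r full turns and
    cancel.\<close>
  also have "\<alpha> + h / 2 - real (Suc M) * h = (\<alpha> - h / 2) + 2 * pi * of_int (- r)"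
    using M by (simp add: h_def field_simps)
  also have "sin \<dots> = sin (\<alpha> - h / 2)"
    unfolding sin_add sin_int_2pin cos_int_2pin by simp
  finally have "(\<Sum>j=1..M. cos (\<alpha> - real j * h)) = 0" using nz by simp
  moreover have "of_int r * (2 * pi * real j / real M) = real j * h" for j
    by (simp add: h_def)
  ultimately show ?thesis using False by simp
qed

lemma has_integral_cos_multiple:
  "((\<lambda>t. cos (real k * t)) has_integral (if k = 0 then pi else 0)) {0..pi}"
proof (cases "k = 0")
  case True
  then show ?thesis using has_integral_const_real[of "1::real" 0 pi] by simp
next
  case False
  have "((\<lambda>t. cos (real k * t)) has_integral
      (sin (real k * pi) / real k - sin (real k * 0) / real k)) {0..pi}"
    by (rule fundamental_theorem_of_calculus)
      (use False in \<open>auto intro!: derivative_eq_intros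
        simp flip: has_real_derivative_iff_has_vector_derivative\<close>)
  then show ?thesis using False by simp
qed

text \<open>All frequencies are below M, so both sides see only the constant coefficient: the sum is
  M times it, the integral pi times it.\<close>

lemma quadrature_cos_poly:
  assumes "cos_poly d f" "d \<le> M" "M > 0"
  shows "(\<Sum>j=1..M. f (2 * pi * real j / real M)) = real M / pi * integral {0..pi} f"
proof -
  obtain a where a: "\<And>t. f t = (\<Sum>k<d. a k * cos (real k * t))"
    using assms unfolding cos_poly_def by metis
  have "(\<Sum>j=1..M. f (2 * pi * real j / real M))
      = (\<Sum>k<d. a k * (\<Sum>j=1..M. cos (0 - of_int (int k) * (2 * pi * real j / real M))))"
    unfolding a by (subst sum.swap) (simp add: sum_distrib_left)
  also have "\<dots> = (\<Sum>k<d. a k * (if int k = 0 then real M * cos 0 else 0))"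
    by (intro sum.cong refl, subst sum_cos_equally_spaced) (use assms in auto)
  also have "\<dots> = (\<Sum>k<d. real M / pi * (a k * (if k = 0 then pi else 0)))"
    by (intro sum.cong) auto
  also have "\<dots> = real M / pi * (\<Sum>k<d. a k * (if k = 0 then pi else 0))"
    by (simp add: sum_distrib_left)
  also have "(f has_integral (\<Sum>k<d. a k * (if k = 0 then pi else 0))) {0..pi}"
    unfolding a[abs_def]
    by (intro has_integral_sum has_integral_mult_right has_integral_cos_multiple) auto
  then have "(\<Sum>k<d. a k * (if k = 0 then pi else 0)) = integral {0..pi} f"
    by (simp add: integral_unique)
  finally show ?thesis .
qed

section \<open>The Fejer kernel and its discrete convolution with cosines\<close>

definition fejer :: "nat \<Rightarrow> real \<Rightarrow> real" where
  "fejer m t = (\<Sum>a<m. \<Sum>b<m. cos (of_int (int a - int b) * t))"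

text \<open>The double sum is the squared modulus of the sum of exp(i a t) over a < m, written with
  real and imaginary parts.\<close>

lemma fejer_nonneg: "fejer m t \<ge> 0"
proof -
  have "fejer m t = (\<Sum>a<m. cos (real a * t))\<^sup>2 + (\<Sum>a<m. sin (real a * t))\<^sup>2"
    unfolding fejer_def power2_eq_square sum_product sum.distrib[symmetric]
    by (intro sum.cong refl) (simp add: left_diff_distrib cos_diff)
  then show ?thesis by simp
qed

text \<open>The k-th diagonal of an m by m square has m - k entries.\<close>

lemma sum_if_diff_eq:
  assumes "k \<le> m"
  shows "(\<Sum>a<m. \<Sum>b<m. if int a - int b = int k then c else 0) = real (m - k) * (c::real)"
proof -
  have "(\<Sum>a<m. \<Sum>b<m. if int a - int b = int k then c else 0)
      = (\<Sum>a<m. if a \<in> {k..<m} then c else 0)"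
  proof (rule sum.cong[OF refl])
    fix a assume a: "a \<in> {..<m}"
    \<comment> \<open>The guard \<open>a \<ge> k\<close> is there because \<open>a - k\<close>
      truncates to 0 otherwise.\<close>
    have "(\<Sum>b<m. if int a - int b = int k then c else 0)
        = (\<Sum>b<m. if b = a - k then (if a \<ge> k then c else 0) else 0)"
      by (intro sum.cong) auto
    then show "(\<Sum>b<m. if int a - int b = int k then c else 0) = (if a \<in> {k..<m} then c else 0)"
      using a by (simp add: less_imp_diff_less)
  qed
  also have "\<dots> = real (card ({..<m} \<inter> {k..<m})) * c"
    by (subst sum.inter_restrict[symmetric]) auto
  also have "{..<m} \<inter> {k..<m} = {k..<m}" by auto
  finally show ?thesis by simp
qed

text \<open>Product-to-sum yields sampled frequencies a - b - k and a - b + k, of size at most m - 1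
  + k < M, so there is no aliasing. Only the diagonals a - b = k and a - b = -k survive, with m - k
  pairs each and weight 1/2.\<close>

lemma fejer_convolution_cos:
  assumes "m + k \<le> M" "k \<le> m"
  shows "(\<Sum>j=1..M. cos (real k * (2 * pi * real j / real M)) * fejer m (t - 2 * pi * real j / real M))
    = real M * real (m - k) * cos (real k * t)"
proof -
  define \<theta> where "\<theta> j = 2 * pi * real j / real M" for j
  let ?s = "\<lambda>a b. int a - int b"
  have "(\<Sum>j=1..M. cos (real k * \<theta> j) * fejer m (t - \<theta> j))
      = (\<Sum>a<m. \<Sum>b<m. \<Sum>j=1..M. cos (real k * \<theta> j) * cos (of_int (?s a b) * (t - \<theta> j)))"
    unfolding fejer_def sum_distrib_left
    by (simp only: sum.swap[where A = "{1..M}" and B = "{..<m}"])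
  also have "\<dots> = (\<Sum>a<m. \<Sum>b<m.
      (\<Sum>j=1..M. cos (of_int (?s a b) * t - of_int (?s a b - int k) * \<theta> j)) / 2
      + (\<Sum>j=1..M. cos (of_int (?s a b) * t - of_int (?s a b + int k) * \<theta> j)) / 2)"
  proof (intro sum.cong refl)
    fix a b
    have "cos (real k * \<theta> j) * cos (of_int (?s a b) * (t - \<theta> j))
      = cos (of_int (?s a b) * t - of_int (?s a b - int k) * \<theta> j) / 2
      + cos (of_int (?s a b) * t - of_int (?s a b + int k) * \<theta> j) / 2" for j
      using cos_times_cos[of "of_int (?s a b) * (t - \<theta> j)" "real k * \<theta> j"]
      by (simp add: algebra_simps add_divide_distrib)
    then show "(\<Sum>j=1..M. cos (real k * \<theta> j) * cos (of_int (?s a b) * (t - \<theta> j))) =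
      (\<Sum>j=1..M. cos (of_int (?s a b) * t - of_int (?s a b - int k) * \<theta> j)) / 2
      + (\<Sum>j=1..M. cos (of_int (?s a b) * t - of_int (?s a b + int k) * \<theta> j)) / 2"
      by (simp add: sum.distrib sum_divide_distrib)
  qed
  also have "\<dots> = (\<Sum>a<m. \<Sum>b<m.
      (if ?s a b = int k then real M * cos (real k * t) / 2 else 0)
      + (if ?s b a = int k then real M * cos (real k * t) / 2 else 0))"
  proof (intro sum.cong refl)
    fix a b assume ab: "a \<in> {..<m}" "b \<in> {..<m}"
    have "(\<Sum>j=1..M. cos (of_int (?s a b) * t - of_int (?s a b - int k) * \<theta> j))
        = (if ?s a b - int k = 0 then real M * cos (of_int (?s a b) * t) else 0)"
      unfolding \<theta>_def by (rule sum_cos_equally_spaced) (use ab assms in auto)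
    moreover have "(\<Sum>j=1..M. cos (of_int (?s a b) * t - of_int (?s a b + int k) * \<theta> j))
        = (if ?s a b + int k = 0 then real M * cos (of_int (?s a b) * t) else 0)"
      unfolding \<theta>_def by (rule sum_cos_equally_spaced) (use ab assms in auto)
    moreover have "cos (of_int (?s a b) * t) = cos (real k * t)" if "?s a b = int k"
      unfolding that by simp
    moreover have "cos (of_int (?s a b) * t) = cos (real k * t)" if "?s b a = int k"
    proof -
      have "?s a b = - int k" using that by simp
      then show ?thesis by simp
    qed
    ultimately show "(\<Sum>j=1..M. cos (of_int (?s a b) * t - of_int (?s a b - int k) * \<theta> j)) / 2
      + (\<Sum>j=1..M. cos (of_int (?s a b) * t - of_int (?s a b + int k) * \<theta> j)) / 2
      = (if ?s a b = int k then real M * cos (real k * t) / 2 else 0)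
      + (if ?s b a = int k then real M * cos (real k * t) / 2 else 0)"
      by (smt (verit) div_0)
  qed
  \<comment> \<open>Swapping the sums in the second family brings it to the same diagonal count as
    the first.\<close>
  also have "\<dots> = (\<Sum>a<m. \<Sum>b<m. if ?s a b = int k then real M * cos (real k * t) / 2 else 0)
      + (\<Sum>b<m. \<Sum>a<m. if ?s b a = int k then real M * cos (real k * t) / 2 else 0)"
    unfolding sum.distrib by (subst (3) sum.swap) simp
  also have "\<dots> = real M * real (m - k) * cos (real k * t)"
    unfolding sum_if_diff_eq[OF assms(2)] by simp
  finally show ?thesis unfolding \<theta>_def .
qed

section \<open>Bounding a cosine polynomial by its samples\<close>

lemma cos_poly_bound_from_samples:
  assumes f: "cos_poly n f" and n: "n \<ge> 1"
    and B: "\<And>j. j \<in> {1..4*n} \<Longrightarrow> \<bar>f (2 * pi * real j / real (4*n))\<bar> \<le> B"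
  shows "\<bar>f t\<bar> \<le> 2 * B"
proof -
  obtain a where a: "\<And>t. f t = (\<Sum>k<n. a k * cos (real k * t))"
    using f unfolding cos_poly_def by metis
  define \<theta> where "\<theta> j = 2 * pi * real j / real (4*n)" for j
  \<comment> \<open>For k < n, the lower bound on m gives k \<le> m and the upper one gives m + k
    \<le> 4 n, as the convolution formula requires.\<close>
  have conv: "(\<Sum>j=1..4*n. f (\<theta> j) * fejer m (t - \<theta> j))
      = (\<Sum>k<n. a k * (real (4*n) * real (m - k) * cos (real k * t)))"
    if "n \<le> m" "m \<le> 3*n" for m
  proof -
    have "(\<Sum>j=1..4*n. f (\<theta> j) * fejer m (t - \<theta> j))
        = (\<Sum>k<n. a k * (\<Sum>j=1..4*n. cos (real k * \<theta> j) * fejer m (t - \<theta> j)))"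
      unfolding a sum_distrib_right sum_distrib_left
      by (subst sum.swap) (simp add: mult.assoc)
    also have "\<dots> = (\<Sum>k<n. a k * (real (4*n) * real (m - k) * cos (real k * t)))"
      unfolding \<theta>_def
      by (intro sum.cong refl, subst fejer_convolution_cos) (use that n in auto)
    finally show ?thesis .
  qed
  \<comment> \<open>This is frequency k = 0. By nonnegativity it is also the sum of the absolute
    values of the kernel.\<close>
  have mass: "(\<Sum>j=1..4*n. fejer m (t - \<theta> j)) = real (4*n) * real m" if "n \<le> m" "m \<le> 3*n" for m
    using fejer_convolution_cos[of m 0 "4*n" t] that n by (simp add: \<theta>_def)
  have bnd: "\<bar>\<Sum>j=1..4*n. f (\<theta> j) * fejer m (t - \<theta> j)\<bar> \<le> B * (real (4*n) * real m)"
    if "n \<le> m" "m \<le> 3*n" for m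
  proof -
    have "\<bar>\<Sum>j=1..4*n. f (\<theta> j) * fejer m (t - \<theta> j)\<bar> \<le> (\<Sum>j=1..4*n. B * fejer m (t - \<theta> j))"
      by (rule order.trans[OF sum_abs], rule sum_mono)
        (use B fejer_nonneg in \<open>auto simp: abs_mult \<theta>_def intro!: mult_right_mono\<close>)
    then show ?thesis unfolding sum_distrib_left[symmetric] mass[OF that] .
  qed
  \<comment> \<open>The multiplier (3n - k) - (n - k) = 2n does not depend on k, so the difference
    of kernels reproduces f up to a constant.\<close>
  have "(\<Sum>j=1..4*n. f (\<theta> j) * fejer (3*n) (t - \<theta> j)) - (\<Sum>j=1..4*n. f (\<theta> j) * fejer n (t - \<theta> j))
      = (\<Sum>k<n. real (4*n) * real (2*n) * (a k * cos (real k * t)))"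
    by (subst conv, simp, simp, subst conv, simp, simp, subst sum_subtractf[symmetric],
        intro sum.cong refl) (simp add: of_nat_diff algebra_simps)
  also have "\<dots> = real (4*n) * real (2*n) * f t"
    by (simp add: a sum_distrib_left)
  finally have "real (4*n) * real (2*n) * \<bar>f t\<bar>
      = \<bar>(\<Sum>j=1..4*n. f (\<theta> j) * fejer (3*n) (t - \<theta> j)) - (\<Sum>j=1..4*n. f (\<theta> j) * fejer n (t - \<theta> j))\<bar>"
    by (simp add: abs_mult)
  also have "\<dots> \<le> B * (real (4*n) * real (3*n)) + B * (real (4*n) * real n)"
    using bnd[of "3*n"] bnd[of n] by simp
  also have "\<dots> = real (4*n) * real (2*n) * (2 * B)"
    by (simp add: algebra_simps)
  finally show ?thesis
    using n by (simp add: mult_le_cancel_left)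
qed

section \<open>The Komlos hypothesis and its use on sample vectors\<close>

lemma komlos_constant_ge_1:
  assumes "komlos_conjecture C"
  shows "C \<ge> 1"
proof -
  \<comment> \<open>In dimension 1 the vector 1 has signed sum 1 or -1, of norm 1.\<close>
  have "\<exists>x :: nat \<Rightarrow> real. (\<forall>i\<in>{1..1}. x i \<in> {-1, 1}) \<and>
      max_norm 1 (\<lambda>j. \<Sum>i=1..1. x i * (\<lambda>_ _. 1) i j) \<le> C"
    using assms[unfolded komlos_conjecture_def, rule_format, of 1 "\<lambda>_ _. 1"]
    by (simp add: L2_set_def)
  then show ?thesis by (auto simp: max_norm_def)
qed

theorem theorem3:
  fixes C :: real and n :: nat and p :: "nat \<Rightarrow> real poly"
  assumes "komlos_conjecture C"
    and "n \<ge> 1"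
    and "\<And>i. i \<in> {1..n} \<Longrightarrow> degree (p i) < n"
    and "\<And>i. i \<in> {1..n} \<Longrightarrow> integral {0..pi} (\<lambda>\<theta>. (poly (p i) (cos \<theta>))\<^sup>2) \<le> 1"
  shows "\<exists>x :: nat \<Rightarrow> real. (\<forall>i\<in>{1..n}. x i \<in> {-1, 1}) \<and>
    chebyshev_norm (\<Sum>i=1..n. smult (x i) (p i)) < 3 * C * sqrt (real n)"
proof -
  \<comment> \<open>The kernels of order up to 3n, tested on frequencies below n, ask for 4n points;
    the squares have degree at most 2n - 2, within reach of the quadrature.\<close>
  define M where "M = 4 * n"
  \<comment> \<open>Chosen so that c^2 cancels the quadrature factor M / pi.\<close>
  define c where "c = sqrt (pi / real M)"
  define \<theta> where "\<theta> j = 2 * pi * real j / real M" for j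
  \<comment> \<open>Zero vectors pad the family, since the hypothesis takes as many vectors as
    coordinates.\<close>
  define v where "v i j = (if i \<le> n then c * poly (p i) (cos (\<theta> j)) else 0)" for i j
  have M: "M \<ge> 1" and c: "c > 0" using assms(2) by (simp_all add: M_def c_def)
  have "L2_set (v i) {1..M} \<le> 1" if i: "i \<in> {1..M}" for i
  proof (cases "i \<le> n")
    case False
    then show ?thesis by (simp add: v_def L2_set_def)
  next
    case True
    then have i: "i \<in> {1..n}" using i by simp
    have "degree (p i * p i) < M"
      using degree_mult_le[of "p i" "p i"] assms(3)[OF i] by (simp add: M_def)
    then have "cos_poly M (\<lambda>t. (poly (p i) (cos t))\<^sup>2)"
      using cos_poly_poly[of "p i * p i" M] by (simp add: power2_eq_square)
    then have "(\<Sum>j=1..M. (poly (p i) (cos (\<theta> j)))\<^sup>2)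
        = real M / pi * integral {0..pi} (\<lambda>t. (poly (p i) (cos t))\<^sup>2)"
      unfolding \<theta>_def by (rule quadrature_cos_poly) (use M in auto)
    also have "\<dots> \<le> real M / pi * 1"
      using assms(4)[OF i] by (intro mult_left_mono) auto
    finally have "c\<^sup>2 * (\<Sum>j=1..M. (poly (p i) (cos (\<theta> j)))\<^sup>2) \<le> c\<^sup>2 * (real M / pi)"
      by (intro mult_left_mono) auto
    also have "\<dots> = 1" using M by (simp add: c_def)
    finally show ?thesis
      using True by (simp add: L2_set_def v_def power_mult_distrib sum_distrib_left)
  qed
  then obtain x :: "nat \<Rightarrow> real" where x: "\<forall>i\<in>{1..M}. x i \<in> {-1, 1}"
    and xC: "max_norm M (\<lambda>j. \<Sum>i=1..M. x i * v i j) \<le> C"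
    using assms(1)[unfolded komlos_conjecture_def, rule_format, OF M, of v] by blast
  define q where "q = (\<Sum>i=1..n. smult (x i) (p i))"
  have "degree q < n"
    unfolding q_def using assms(2,3)
    by (intro degree_sum_less) (auto intro: le_less_trans[OF degree_smult_le])
  then have q: "cos_poly n (\<lambda>t. poly q (cos t))" by (rule cos_poly_poly)
  have "\<bar>poly q (cos (\<theta> j))\<bar> \<le> C / c" if j: "j \<in> {1..M}" for j
  proof -
    have "(\<Sum>i=1..M. x i * v i j) = (\<Sum>i=1..n. x i * v i j)"
      by (rule sum.mono_neutral_right) (auto simp: v_def M_def)
    also have "\<dots> = c * poly q (cos (\<theta> j))"
      by (simp add: q_def v_def poly_sum sum_distrib_left mult.left_commute)
    finally have "\<bar>c * poly q (cos (\<theta> j))\<bar> = \<bar>\<Sum>i=1..M. x i * v i j\<bar>" by simp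
    also have "\<dots> \<le> max_norm M (\<lambda>j. \<Sum>i=1..M. x i * v i j)"
      unfolding max_norm_def using j by (intro Max_ge) auto
    finally show ?thesis using xC c by (simp add: abs_mult field_simps)
  qed
  then have bound: "\<bar>poly q (cos t)\<bar> \<le> 2 * (C / c)" for t
    by (intro cos_poly_bound_from_samples[OF q assms(2)]) (auto simp: \<theta>_def M_def)
  have "chebyshev_norm q \<le> 2 * (C / c)"
    unfolding chebyshev_norm_def
  proof (rule cSUP_least)
    fix y :: real assume "y \<in> {-1..1}"
    then show "\<bar>poly q y\<bar> \<le> 2 * (C / c)" using bound[of "arccos y"] by simp
  qed simp
  also have "2 * (C / c) < 3 * C * sqrt (real n)"
  proof -
    \<comment> \<open>Since c = sqrt(pi / (4n)), the claim amounts to 2/3 < sqrt(pi/4), and pi > 3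
      suffices.\<close>
    have "sqrt (4/9) < sqrt (pi / 4)"
      using pi_gt3 by (intro real_sqrt_less_mono) simp
    then have "2 < 3 * sqrt (pi / 4)" by (simp add: real_sqrt_divide)
    also have "sqrt (pi / 4) = sqrt (real n) * c"
      unfolding c_def real_sqrt_mult[symmetric] using assms(2) by (simp add: M_def)
    \<comment> \<open>Strictness survives multiplication by C because C \<ge> 1 makes it
      positive.\<close>
    finally have "C * 2 < C * (3 * (sqrt (real n) * c))"
      using komlos_constant_ge_1[OF assms(1)] by (intro mult_strict_left_mono) auto
    then show ?thesis using c by (simp add: field_simps)
  qed
  finally show ?thesis
    using x by (intro exI[of _ x]) (auto simp: q_def M_def)
qed

end
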